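(* For each $d \in \mathbb{N} \setminus \{0\}$ let $B_d\subset\mathbb{R}^d$ be a $d$-dimensional parallelotope centered at zero. Then, for every $d\in \mathbb{N} \setminus \{0\}$, \[ c_{d,B_d} \le c_{d+1,B_{d+1}}, \] and likewise, for every lacunary bisequence $s$, \[ c_{s,d,B_d} \le c_{s,d+1,B_{d+1}}. \] Here $c_{d,B}$ and $c_{s,d,B}$ are the best constants in the weak type $(1,1)$ inequalities for the centered Hardy-Littlewood maximal operator $M_{d,B}$ and for the lacunary maximal operator $M_{s,d,B}$, respectively.
   Context: $\lambda^d$ is $d$-dimensional Lebesgue measure. A ball $B\subset\mathbb{R}^d$ is an open, bounded, convex set, symmetric about zero (nonempty); in particular parallelotopes centered at zero are taken to be open and nondegenerate. The centered Hardy-Littlewood maximal operator associated to a ball $B$ is defined for locally integrable $f\colon\mathbb{R}^d\to\mathbb{R}$ by \[ M_{d,B} f(x) := \sup_{r > 0} \left(\frac{\chi_{rB}}{r^d \lambda^d (B)}*|f|\right)(x). \] A lacunary bisequence is a sequence $s=\{r_n\}_{n\in\mathbb{Z}}$ of positive numbers such that $r_{n+1}/r_n\ge q$ for some fixed constant $q>1$ and every $n\in\mathbb{Z}$. The associated lacunary maximal operator is \[ M_{s,d,B} f(x) := \sup_{n\in\mathbb{Z}} \left(\frac{\chi_{r_nB}}{r_n^d \lambda^d (B)}*|f|\right)(x). \] The best constant $c_{d,B}$ is the least constant $c$ such that $\alpha\,\lambda^d\{M_{d,B}f>\alpha\}\le c\,\|f\|_1$ for all $f\in L^1(\mathbb{R}^d)$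 and all $\alpha>0$; $c_{s,d,B}$ is the least such constant with $M_{s,d,B}$ in place of $M_{d,B}$. *)

theory Defs
  imports "HOL-Analysis.Analysis"
begin

definition centered_parallelotope :: "(real ^ 'n) set \<Rightarrow> bool" where
  "centered_parallelotope B \<longleftrightarrow>
     (\<exists>v :: 'n \<Rightarrow> real ^ 'n. inj v \<and> independent (range v) \<and>
        B = {\<Sum>i\<in>UNIV. t i *\<^sub>R v i | t. \<forall>i. \<bar>t i\<bar> < 1})"

text \<open>The convolution of the normalized indicator function of \<open>r B\<close> with \<open>\<bar>f\<bar>\<close>. It and the
  maximal functions below take values in \<open>[0, \<infinity>]\<close>.\<close>

definition ball_average :: "(real ^ 'n) set \<Rightarrow> real \<Rightarrow> (real ^ 'n \<Rightarrow> real) \<Rightarrow> real ^ 'n \<Rightarrow> ennreal" where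
  "ball_average B r f x =
     (\<integral>\<^sup>+ y. indicator ((\<lambda>z. r *\<^sub>R z) ` B) (x - y) * ennreal \<bar>f y\<bar> \<partial>lebesgue)
       / (ennreal (r ^ CARD('n)) * emeasure lebesgue B)"

definition maximal_op :: "(real ^ 'n) set \<Rightarrow> (real ^ 'n \<Rightarrow> real) \<Rightarrow> real ^ 'n \<Rightarrow> ennreal" where
  "maximal_op B f x = (SUP r\<in>{0<..}. ball_average B r f x)"

definition lacunary_bisequence :: "(int \<Rightarrow> real) \<Rightarrow> bool" where
  "lacunary_bisequence s \<longleftrightarrow>
     (\<forall>n. s n > 0) \<and> (\<exists>q>1. \<forall>n. s (n + 1) / s n \<ge> q)"

definition lacunary_maximal_op ::
    "(int \<Rightarrow> real) \<Rightarrow> (real ^ 'n) set \<Rightarrow> (real ^ 'n \<Rightarrow> real) \<Rightarrow> real ^ 'n \<Rightarrow> ennreal" where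
  "lacunary_maximal_op s B f x = (SUP n. ball_average B (s n) f x)"

definition weak_type_bound :: "((real ^ 'n \<Rightarrow> real) \<Rightarrow> real ^ 'n \<Rightarrow> ennreal) \<Rightarrow> ennreal \<Rightarrow> bool" where
  "weak_type_bound T c \<longleftrightarrow>
     (\<forall>f. integrable lebesgue f \<longrightarrow>
        (\<forall>\<alpha>::real. \<alpha> > 0 \<longrightarrow>
           ennreal \<alpha> * emeasure lebesgue {x. T f x > ennreal \<alpha>}
             \<le> c * ennreal (\<integral>x. \<bar>f x\<bar> \<partial>lebesgue)))"

text \<open>The best constant is an infimum in \<open>[0, \<infinity>]\<close>, hence \<open>\<infinity>\<close> if there is no finite bound.
  The infimum is attained, because the defining inequality is closed in \<open>c\<close>.\<close>

definition best_weak_constant :: "((real ^ 'n \<Rightarrow> real) \<Rightarrow> real ^ 'n \<Rightarrow> ennreal) \<Rightarrow> ennreal" where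
  "best_weak_constant T = Inf {c. weak_type_bound T c}"

definition hl_constant :: "(real ^ 'n) set \<Rightarrow> ennreal" where
  "hl_constant B = best_weak_constant (maximal_op B)"

definition lacunary_constant :: "(int \<Rightarrow> real) \<Rightarrow> (real ^ 'n) set \<Rightarrow> ennreal" where
  "lacunary_constant s B = best_weak_constant (lacunary_maximal_op s B)"

end

theory Submission imports Defs begin

text \<open>
  A function \<open>f\<close> on the lower-dimensional space becomes a function of one more variable by making
  it constant along the new axis and cutting it off: \<open>F (x, t) = f x\<close> for \<open>\<bar>t\<bar> < L\<close> and \<open>0\<close>
  otherwise. In linear coordinates adapted to the two parallelotopes, \<open>B'\<close> is the product
  \<open>B \<times> (-1, 1)\<close>. Hence the average of \<open>F\<close> over \<open>(x, t) + r B'\<close> is exactly the average of \<open>f\<close> over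
  \<open>x + r B\<close> as long as the segment \<open>(t - r, t + r)\<close> does not leave \<open>(-L, L)\<close>
  (\<open>ball_average_cylinder\<close>). The choice of coordinates is harmless, because a linear
  bijection changes all volumes by one common factor \<open>k\<close>, which cancels in averages and appears on
  both sides of the weak type inequality.

  If only radii up to \<open>R\<close> are admitted, the superlevel set of the maximal function of \<open>F\<close> therefore
  contains the product of that of \<open>f\<close> with an interval of length \<open>2 (L - R)\<close>, while the norm of
  \<open>F\<close> is \<open>2 L\<close> times that of \<open>f\<close>. A weak type constant \<open>c\<close> for \<open>B'\<close> thus gives
  \<open>\<alpha> \<lambda>(E) (L - R) \<le> c \<parallel>f\<parallel> L\<close>, and \<open>L \<longlonglongrightarrow> \<infinity>\<close> removes the loss at the ends of the cylinder
  (\<open>weak_type_bound_transfer_bounded_radii\<close>). Letting \<open>R \<longlonglongrightarrow> \<infinity>\<close> exhausts the full superlevel set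
  from below (\<open>weak_type_bound_transfer\<close>).

  Since the argument compares the averages radius by radius, it works for the supremum over any set
  of positive radii; the Hardy-Littlewood and the lacunary operators are the cases of all
  radii and of the range of the bisequence.
\<close>

section \<open>Lebesgue measure under a linear change of variables\<close>

lemma nn_integral_lborel_add:
  fixes a :: "'a::euclidean_space"
  assumes [measurable]: "f \<in> borel_measurable borel"
  shows "(\<integral>\<^sup>+x. f (a + x) \<partial>lborel) = (\<integral>\<^sup>+x. f x \<partial>lborel)"
proof -
  have "(\<integral>\<^sup>+x. f x \<partial>lborel) = (\<integral>\<^sup>+x. f x \<partial>distr lborel borel ((+) a))"
    by (simp add: lborel_distr_plus)
  also have "\<dots> = (\<integral>\<^sup>+x. f (a + x) \<partial>lborel)"
    by (subst nn_integral_distr) auto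
  finally show ?thesis by simp
qed

lemma borel_measurable_linear:
  fixes f :: "'a::euclidean_space \<Rightarrow> 'b::euclidean_space"
  shows "linear f \<Longrightarrow> f \<in> borel_measurable borel"
  by (intro borel_measurable_continuous_onI linear_continuous_on)
     (simp add: linear_conv_bounded_linear)

lemma linear_inv_of_bij:
  assumes "linear f" "bij f"
  shows "linear (inv f)"
proof (rule linearI)
  have f: "f (inv f y) = y" for y
    using assms(2) by (simp add: bij_is_surj surj_f_inv_f)
  fix x y and c :: real
  show "inv f (x + y) = inv f x + inv f y"
    by (rule bij_is_inj[OF assms(2), THEN injD]) (simp add: f linear_add[OF assms(1)])
  show "inv f (c *\<^sub>R x) = c *\<^sub>R inv f x"
    by (rule bij_is_inj[OF assms(2), THEN injD]) (simp add: f linear_scale[OF assms(1)])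
qed

text \<open>
  This is the uniqueness of Haar measure up to a factor, for the Lebesgue measure of the target
  carried back along \<open>\<phi>\<close>. Both measures are translation invariant, so the double integral of
  \<open>g z * indicator U (y - \<psi> z)\<close> can be computed in two ways: integrating first over \<open>y\<close> gives the
  volume of \<open>U\<close> times the integral of \<open>g\<close>, and shifting \<open>z\<close> by \<open>\<phi> y\<close> first separates \<open>y\<close> from the
  indicator and gives the volume of \<open>\<phi> ` U\<close> times the integral of \<open>g \<circ> \<phi>\<close>.
\<close>

lemma linear_change_of_variables:
  fixes \<phi> :: "'a::euclidean_space \<Rightarrow> 'b::euclidean_space"
  assumes lin: "linear \<phi>" and bij: "bij \<phi>"
  obtains k where "0 < k" "k < \<infinity>"
    "\<And>g. g \<in> borel_measurable borel \<Longrightarrow>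
       (\<integral>\<^sup>+z. g z \<partial>lborel) = k * (\<integral>\<^sup>+x. g (\<phi> x) \<partial>lborel)"
proof -
  define \<psi> where "\<psi> = inv \<phi>"
  have \<phi>\<psi>: "\<phi> (\<psi> z) = z" and \<psi>\<phi>: "\<psi> (\<phi> x) = x" for x z
    using bij by (auto simp: \<psi>_def bij_is_surj surj_f_inv_f bij_is_inj)
  have lin': "linear \<psi>"
    unfolding \<psi>_def using lin bij by (rule linear_inv_of_bij)
  have [measurable]: "\<phi> \<in> borel_measurable borel" "\<psi> \<in> borel_measurable borel"
    using lin lin' by (auto intro: borel_measurable_linear)
  \<comment> \<open>any bounded, symmetric, open neighbourhood of \<open>0\<close> would serve as the test set\<close>
  define U where "U = ball (0::'a) 1"
  define V where "V = \<psi> -` U"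
  have [measurable]: "U \<in> sets borel" by (simp add: U_def)
  have U_shift: "(\<integral>\<^sup>+y. indicator U (y - w) \<partial>lborel) = emeasure lborel U" for w
    using nn_integral_lborel_add[of "indicator U" "- w"] by simp
  have U_minus: "- x \<in> U \<longleftrightarrow> x \<in> U" for x by (simp add: U_def)
  have "open V"
    unfolding V_def U_def using lin'
    by (intro open_vimage open_ball linear_continuous_on)
       (simp add: linear_conv_bounded_linear)
  have "V \<subseteq> \<phi> ` U"
  proof
    fix z assume "z \<in> V"
    then show "z \<in> \<phi> ` U" by (intro image_eqI[of z \<phi> "\<psi> z"]) (simp_all add: \<phi>\<psi> V_def)
  qed
  moreover have "bounded (\<phi> ` U)"
    unfolding U_def using lin by (intro bounded_linear_image bounded_ball) (simp add: linear_conv_bounded_linear)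
  ultimately have "bounded V" by (rule bounded_subset[rotated])
  have "0 \<in> V" by (simp add: V_def U_def linear_0[OF lin'])
  have [measurable]: "V \<in> sets borel" using \<open>open V\<close> by auto
  have nonnull: "emeasure lborel W \<noteq> 0" if "open W" "0 \<in> W" for W :: "'c::euclidean_space set"
    using that open_not_negligible[of W]
    by (auto simp: negligible_iff_null_sets null_sets_def null_sets_completion_iff)
  have fin: "emeasure lborel U < \<infinity>" "emeasure lborel V < \<infinity>"
    using emeasure_bounded_finite[OF \<open>bounded V\<close>] emeasure_bounded_finite[OF bounded_ball]
    by (simp_all add: U_def)
  have pos: "emeasure lborel U \<noteq> 0" "emeasure lborel V \<noteq> 0"
    using nonnull[of U] nonnull[of V] \<open>open V\<close> \<open>0 \<in> V\<close> by (auto simp: U_def)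
  have key: "emeasure lborel U * (\<integral>\<^sup>+z. g z \<partial>lborel)
      = emeasure lborel V * (\<integral>\<^sup>+x. g (\<phi> x) \<partial>lborel)"
    if [measurable]: "g \<in> borel_measurable borel" for g
  proof -
    have "emeasure lborel U * (\<integral>\<^sup>+z. g z \<partial>lborel)
        = (\<integral>\<^sup>+z. g z * emeasure lborel U \<partial>lborel)"
      by (simp add: nn_integral_multc mult.commute)
    also have "\<dots> = (\<integral>\<^sup>+z. (\<integral>\<^sup>+y. g z * indicator U (- \<psi> z + y) \<partial>lborel) \<partial>lborel)"
      by (simp add: nn_integral_cmult U_shift)
    also have "\<dots> = (\<integral>\<^sup>+y. (\<integral>\<^sup>+z. g z * indicator U (- \<psi> z + y) \<partial>lborel) \<partial>lborel)"
      by (rule lborel_pair.Fubini') measurable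
    also have "\<dots> = (\<integral>\<^sup>+y. (\<integral>\<^sup>+z. g (\<phi> y + z) * indicator U (- \<psi> z) \<partial>lborel) \<partial>lborel)"
    proof (rule nn_integral_cong)
      fix y :: 'a
      have "(\<integral>\<^sup>+z. g z * indicator U (- \<psi> z + y) \<partial>lborel)
          = (\<integral>\<^sup>+z. g (\<phi> y + z) * indicator U (- \<psi> (\<phi> y + z) + y) \<partial>lborel)"
        by (rule nn_integral_lborel_add[symmetric]) measurable
      then show "(\<integral>\<^sup>+z. g z * indicator U (- \<psi> z + y) \<partial>lborel)
          = (\<integral>\<^sup>+z. g (\<phi> y + z) * indicator U (- \<psi> z) \<partial>lborel)"
        by (simp add: linear_add[OF lin'] \<psi>\<phi>)
    qed
    also have "\<dots> = (\<integral>\<^sup>+z. (\<integral>\<^sup>+y. g (\<phi> y + z) * indicator U (- \<psi> z) \<partial>lborel) \<partial>lborel)"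
      by (rule lborel_pair.Fubini') measurable
    also have "\<dots> = (\<integral>\<^sup>+z. indicator V z * (\<integral>\<^sup>+x. g (\<phi> x) \<partial>lborel) \<partial>lborel)"
    proof (rule nn_integral_cong)
      fix z
      have "(\<integral>\<^sup>+y. g (\<phi> y + z) \<partial>lborel) = (\<integral>\<^sup>+y. g (\<phi> (\<psi> z + y)) \<partial>lborel)"
        by (simp add: linear_add[OF lin] \<phi>\<psi> add.commute)
      also have "\<dots> = (\<integral>\<^sup>+x. g (\<phi> x) \<partial>lborel)"
        by (rule nn_integral_lborel_add) measurable
      finally show "(\<integral>\<^sup>+y. g (\<phi> y + z) * indicator U (- \<psi> z) \<partial>lborel)
          = indicator V z * (\<integral>\<^sup>+x. g (\<phi> x) \<partial>lborel)"
        by (simp add: nn_integral_multc mult.commute indicator_def U_minus V_def)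
    qed
    also have "\<dots> = emeasure lborel V * (\<integral>\<^sup>+x. g (\<phi> x) \<partial>lborel)"
      by (simp add: nn_integral_multc)
    finally show ?thesis .
  qed
  show thesis
  proof (rule that[of "emeasure lborel V / emeasure lborel U"])
    show "0 < emeasure lborel V / emeasure lborel U"
      using pos fin by (simp add: ennreal_zero_less_divide zero_less_iff_neq_zero)
    show "emeasure lborel V / emeasure lborel U < \<infinity>"
      using pos fin by (simp add: less_top[symmetric] ennreal_divide_eq_top_iff)
    fix g :: "'b \<Rightarrow> ennreal" assume g: "g \<in> borel_measurable borel"
    have "(\<integral>\<^sup>+z. g z \<partial>lborel)
        = (emeasure lborel U * (\<integral>\<^sup>+z. g z \<partial>lborel)) / emeasure lborel U"
      using pos fin by (subst mult.commute, subst mult_divide_eq_ennreal) auto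
    also have "\<dots> = emeasure lborel V / emeasure lborel U * (\<integral>\<^sup>+x. g (\<phi> x) \<partial>lborel)"
      unfolding key[OF g] by (simp only: ennreal_divide_times) (simp only: ennreal_times_divide)
    finally show "(\<integral>\<^sup>+z. g z \<partial>lborel)
        = emeasure lborel V / emeasure lborel U * (\<integral>\<^sup>+x. g (\<phi> x) \<partial>lborel)" .
  qed
qed

section \<open>Linear coordinates of parallelotopes\<close>

text \<open>
  The map \<open>C\<close> reads off the coefficients of a vector in the basis formed by the edges of \<open>B\<close>.
\<close>

lemma centered_parallelotope_coordinates:
  fixes B :: "(real ^ 'n) set"
  assumes "centered_parallelotope B"
  obtains C :: "real ^ 'n \<Rightarrow> real ^ 'n"
  where "linear C" "bij C" "\<And>x. x \<in> B \<longleftrightarrow> (\<forall>i. \<bar>C x $ i\<bar> < 1)"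
proof -
  obtain v :: "'n \<Rightarrow> real ^ 'n" where v: "inj v" "independent (range v)"
    and B: "B = {\<Sum>i\<in>UNIV. t i *\<^sub>R v i | t. \<forall>i. \<bar>t i\<bar> < 1}"
    using assms unfolding centered_parallelotope_def by blast
  define T where "T = (\<lambda>a :: real ^ 'n. \<Sum>i\<in>UNIV. a $ i *\<^sub>R v i)"
  have T: "linear T"
    unfolding T_def
    by (rule linearI) (simp_all add: scaleR_left_distrib sum.distrib scaleR_right.sum)
  have "inj T"
  proof (rule linear_injective_0[OF T, THEN iffD2], intro allI impI)
    fix a assume "T a = 0"
    then have "(\<Sum>w\<in>range v. (a $ inv v w) *\<^sub>R w) = 0"
      by (simp add: T_def sum.reindex[OF v(1)] inv_f_f[OF v(1)])
    then have "\<forall>w\<in>range v. a $ inv v w = 0"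
      using independentD[OF v(2), of "range v" "\<lambda>w. a $ inv v w"] by auto
    then show "a = 0" by (simp add: vec_eq_iff inv_f_f[OF v(1)])
  qed
  then have "bij T"
    using linear_injective_imp_surjective[OF T] by (simp add: bij_def)
  show thesis
  proof (rule that[of "inv T"])
    show "linear (inv T)" using T \<open>bij T\<close> by (rule linear_inv_of_bij)
    show "bij (inv T)" using \<open>bij T\<close> by (rule bij_imp_bij_inv)
    fix x
    have "x \<in> B \<longleftrightarrow> (\<exists>a. x = T a \<and> (\<forall>i. \<bar>a $ i\<bar> < 1))"
    proof
      assume "x \<in> B"
      then obtain t where "x = (\<Sum>i\<in>UNIV. t i *\<^sub>R v i)" "\<forall>i. \<bar>t i\<bar> < 1" by (auto simp: B)
      then have "x = T (\<chi> i. t i) \<and> (\<forall>i. \<bar>(\<chi> i. t i) $ i\<bar> < 1)" by (simp add: T_def)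
      then show "\<exists>a. x = T a \<and> (\<forall>i. \<bar>a $ i\<bar> < 1)" by blast
    qed (auto simp: B T_def)
    also have "\<dots> \<longleftrightarrow> (\<forall>i. \<bar>inv T x $ i\<bar> < 1)"
      using \<open>bij T\<close> by (metis bij_inv_eq_iff)
    finally show "x \<in> B \<longleftrightarrow> (\<forall>i. \<bar>inv T x $ i\<bar> < 1)" .
  qed
qed

lemma centered_parallelotope_open:
  assumes "centered_parallelotope B"
  shows "open B"
proof -
  obtain C :: "real ^ 'a \<Rightarrow> real ^ 'a"
    where C: "linear C" "\<And>x. x \<in> B \<longleftrightarrow> (\<forall>i. \<bar>C x $ i\<bar> < 1)"
    using centered_parallelotope_coordinates[OF assms] by metis
  have "continuous_on UNIV C"
    using C(1) by (simp add: linear_continuous_on linear_conv_bounded_linear)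
  then have "open (\<Inter>i. {x. \<bar>C x $ i\<bar> < 1})"
    by (intro open_INT finite open_Collect_less continuous_intros ballI) auto
  also have "(\<Inter>i. {x. \<bar>C x $ i\<bar> < 1}) = B" using C(2) by auto
  finally show ?thesis .
qed

text \<open>
  A bijection \<open>e\<close> from the index type of the larger space to the \<open>option\<close> type of the smaller one
  singles out one edge of \<open>B'\<close>, the one labelled \<open>None\<close>, as the new axis and matches the remaining
  edges with those of \<open>B\<close>.
\<close>

lemma parallelotope_product:
  fixes B :: "(real ^ 'n) set" and B' :: "(real ^ 'm) set"
  assumes card: "CARD('m) = CARD('n) + 1"
    and "centered_parallelotope B" "centered_parallelotope B'"
  obtains \<phi> :: "(real ^ 'n) \<times> real \<Rightarrow> real ^ 'm"
  where "linear \<phi>" "bij \<phi>" "\<And>x t. \<phi> (x, t) \<in> B' \<longleftrightarrow> x \<in> B \<and> \<bar>t\<bar> < 1"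
proof -
  obtain C :: "real ^ 'n \<Rightarrow> real ^ 'n"
    where C: "linear C" "bij C" "\<And>x. x \<in> B \<longleftrightarrow> (\<forall>i. \<bar>C x $ i\<bar> < 1)"
    using centered_parallelotope_coordinates[OF assms(2)] by metis
  obtain C' :: "real ^ 'm \<Rightarrow> real ^ 'm"
    where C': "linear C'" "bij C'" "\<And>x. x \<in> B' \<longleftrightarrow> (\<forall>i. \<bar>C' x $ i\<bar> < 1)"
    using centered_parallelotope_coordinates[OF assms(3)] by metis
  have "CARD('n option) = CARD('m)" using card by (simp add: card_UNIV_option)
  then obtain e :: "'m \<Rightarrow> 'n option" where e: "bij e"
    using finite_same_card_bij[of "UNIV :: 'm set" "UNIV :: 'n option set"] by auto
  define \<psi> :: "(real ^ 'n) \<times> real \<Rightarrow> real ^ 'm"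
    where "\<psi> = (\<lambda>(a, t). \<chi> l. case e l of None \<Rightarrow> t | Some i \<Rightarrow> a $ i)"
  have \<psi>: "linear \<psi>"
    by (rule linearI) (auto simp: \<psi>_def vec_eq_iff split: option.split)
  have all_e: "(\<forall>l. P (e l)) \<longleftrightarrow> P None \<and> (\<forall>i. P (Some i))" for P
    using e by (metis bij_pointE option.exhaust)
  have "bij \<psi>"
  proof (rule bijI')
    fix p q show "\<psi> p = \<psi> q \<longleftrightarrow> p = q"
      using all_e[of "\<lambda>u. (case u of None \<Rightarrow> snd p | Some i \<Rightarrow> fst p $ i)
                       = (case u of None \<Rightarrow> snd q | Some i \<Rightarrow> fst q $ i)"]
      by (auto simp: \<psi>_def vec_eq_iff split_beta prod_eq_iff)
  next
    fix b :: "real ^ 'm"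
    have "b = \<psi> (\<chi> i. b $ inv e (Some i), b $ inv e None)"
      using e by (auto simp: \<psi>_def vec_eq_iff bij_inv_eq_iff split: option.split)
         (metis bij_inv_eq_iff)+
    then show "\<exists>p. b = \<psi> p" by blast
  qed
  define \<phi> where "\<phi> = (\<lambda>(x, t). inv C' (\<psi> (C x, t)))"
  have C'_\<phi>: "C' (\<phi> (x, t)) = \<psi> (C x, t)" for x t
    using C'(2) by (simp add: \<phi>_def bij_is_surj surj_f_inv_f)
  have "linear (inv C')" using C'(1,2) by (rule linear_inv_of_bij)
  moreover have "linear (\<lambda>p. (C (fst p), snd p))"
    by (rule linearI) (auto simp: linear_add[OF C(1)] linear_scale[OF C(1)])
  moreover have \<phi>_eq: "\<phi> = inv C' \<circ> \<psi> \<circ> (\<lambda>p. (C (fst p), snd p))"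
    by (auto simp: \<phi>_def)
  ultimately have "linear \<phi>" unfolding \<phi>_eq using \<psi> by (intro linear_compose)
  have "bij (\<lambda>p. (C (fst p), snd p) :: (real ^ 'n) \<times> real)"
    by (rule o_bij[of "\<lambda>p. (inv C (fst p), snd p)"])
       (use C(2) in \<open>auto simp: fun_eq_iff bij_is_inj bij_is_surj surj_f_inv_f\<close>)
  then have "bij \<phi>"
    unfolding \<phi>_eq using \<open>bij \<psi>\<close> C'(2) by (intro bij_comp bij_imp_bij_inv)
  show thesis
  proof (rule that[OF \<open>linear \<phi>\<close> \<open>bij \<phi>\<close>])
    fix x t
    show "\<phi> (x, t) \<in> B' \<longleftrightarrow> x \<in> B \<and> \<bar>t\<bar> < 1"
      using all_e[of "\<lambda>u. \<bar>case u of None \<Rightarrow> t | Some i \<Rightarrow> C x $ i\<bar> < 1"]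
      by (auto simp: C(3) C'(3) C'_\<phi> \<psi>_def)
  qed
qed

section \<open>Averages and maximal functions\<close>

text \<open>
  The indicator of an open set is lower semicontinuous, and Fatou's lemma passes this on to the
  convolution. Openness of superlevel sets survives arbitrary suprema, so it settles the
  measurability of the superlevel sets of maximal functions, also for uncountably many radii.
\<close>

lemma open_superlevel_convolution:
  fixes g :: "'a::euclidean_space \<Rightarrow> ennreal"
  assumes "open U" and [measurable]: "g \<in> borel_measurable borel"
  shows "open {x. c < (\<integral>\<^sup>+y. indicator U (x - y) * g y \<partial>lborel)}" (is "open {x. c < ?I x}")
proof -
  have [measurable]: "U \<in> sets borel" using assms(1) by auto
  have "closed {x. ?I x \<le> c}"
    unfolding closed_sequential_limits
  proof (intro allI impI, elim conjE)
    fix X x assume X: "\<forall>n. X n \<in> {x. ?I x \<le> c}" and lim: "X \<longlonglongrightarrow> x"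
    have "?I x \<le> (\<integral>\<^sup>+y. liminf (\<lambda>n. indicator U (X n - y) * g y) \<partial>lborel)"
    proof (rule nn_integral_mono)
      fix y
      show "indicator U (x - y) * g y \<le> liminf (\<lambda>n. indicator U (X n - y) * g y)"
      proof (cases "x - y \<in> U")
        case True
        have "(\<lambda>n. X n - y) \<longlonglongrightarrow> x - y" using lim by (intro tendsto_intros)
        then have "eventually (\<lambda>n. X n - y \<in> U) sequentially"
          using \<open>open U\<close> True by (rule topological_tendstoD)
        then have "eventually (\<lambda>n. g y \<le> indicator U (X n - y) * g y) sequentially"
          by eventually_elim simp
        then show ?thesis using True by (simp add: Liminf_bounded)
      qed simp
    qed
    also have "\<dots> \<le> liminf (\<lambda>n. ?I (X n))"
      by (rule nn_integral_liminf) measurable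
    also have "\<dots> \<le> c"
      using X by (intro Liminf_le) (auto intro: always_eventually)
    finally show "x \<in> {x. ?I x \<le> c}" by simp
  qed
  then have "open (- {x. ?I x \<le> c})" by (rule open_Compl)
  also have "- {x. ?I x \<le> c} = {x. c < ?I x}" by auto
  finally show ?thesis .
qed

lemma ball_average_lborel:
  assumes "B \<in> sets borel"
  shows "ball_average B r f x =
     (\<integral>\<^sup>+ y. indicator ((\<lambda>z. r *\<^sub>R z) ` B) (x - y) * ennreal \<bar>f y\<bar> \<partial>lborel)
       / (ennreal (r ^ CARD('n)) * emeasure lborel (B :: (real ^ 'n) set))"
  using assms by (simp add: ball_average_def nn_integral_completion)

lemma ball_average_cong_AE:
  assumes "AE y in lebesgue. f y = g y"
  shows "ball_average B r f x = ball_average B r g x"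
proof -
  have "(\<integral>\<^sup>+ y. indicator ((\<lambda>z. r *\<^sub>R z) ` B) (x - y) * ennreal \<bar>f y\<bar> \<partial>lebesgue)
      = (\<integral>\<^sup>+ y. indicator ((\<lambda>z. r *\<^sub>R z) ` B) (x - y) * ennreal \<bar>g y\<bar> \<partial>lebesgue)"
    by (rule nn_integral_cong_AE) (use assms in eventually_elim, simp)
  then show ?thesis by (simp add: ball_average_def)
qed

lemma open_superlevel_ball_average:
  fixes B :: "(real ^ 'n) set"
  assumes "open B" "r > 0" and [measurable]: "f \<in> borel_measurable borel"
  shows "open {x. c < ball_average B r f x}"
proof -
  define D where "D = ennreal (r ^ CARD('n)) * emeasure lborel B"
  have U: "open ((\<lambda>z. r *\<^sub>R z) ` B)" using assms by (intro open_scaling) auto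
  then have [measurable]: "(\<lambda>z. r *\<^sub>R z) ` B \<in> sets borel" by auto
  have [measurable]: "B \<in> sets borel" using \<open>open B\<close> by auto
  have "ball_average B r f x =
      (\<integral>\<^sup>+ y. indicator ((\<lambda>z. r *\<^sub>R z) ` B) (x - y) * (ennreal \<bar>f y\<bar> / D) \<partial>lborel)" for x
    by (simp add: ball_average_lborel D_def[symmetric] ennreal_times_divide nn_integral_divide)
  then show ?thesis using open_superlevel_convolution[OF U, of "\<lambda>y. ennreal \<bar>f y\<bar> / D" c] by simp
qed

text \<open>
  The supremum over an arbitrary set of radii covers both maximal operators at once as well as
  their truncations to bounded radii.
\<close>

definition radii_maximal :: "real set \<Rightarrow> (real ^ 'n) set \<Rightarrow> (real ^ 'n \<Rightarrow> real) \<Rightarrow> real ^ 'n \<Rightarrow> ennreal"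
  where "radii_maximal S B f x = (SUP r\<in>S. ball_average B r f x)"

lemma maximal_op_eq_radii_maximal: "maximal_op B = radii_maximal {0<..} B"
  by (simp add: fun_eq_iff maximal_op_def radii_maximal_def)

lemma lacunary_maximal_op_eq_radii_maximal: "lacunary_maximal_op s B = radii_maximal (range s) B"
  by (simp add: fun_eq_iff lacunary_maximal_op_def radii_maximal_def image_comp o_def)

lemma open_superlevel_radii_maximal:
  fixes B :: "(real ^ 'n) set"
  assumes "open B" "S \<subseteq> {0<..}" "f \<in> borel_measurable borel"
  shows "open {x. c < radii_maximal S B f x}"
proof -
  have "{x. c < radii_maximal S B f x} = (\<Union>r\<in>S. {x. c < ball_average B r f x})"
    by (auto simp: radii_maximal_def less_SUP_iff)
  also have "open \<dots>"
    using assms by (intro open_UN ballI open_superlevel_ball_average) auto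
  finally show ?thesis .
qed

section \<open>Transference to one more dimension\<close>

lemma product_change_of_variables:
  fixes \<phi> :: "'a::euclidean_space \<times> real \<Rightarrow> 'b::euclidean_space"
  assumes lin: "linear \<phi>" and bij: "bij \<phi>"
  obtains k where "0 < k" "k < \<infinity>"
    "\<And>g. g \<in> borel_measurable borel \<Longrightarrow>
       (\<integral>\<^sup>+z. g z \<partial>lborel) = k * (\<integral>\<^sup>+y. (\<integral>\<^sup>+u. g (\<phi> (y, u)) \<partial>lborel) \<partial>lborel)"
proof -
  obtain k where k: "0 < k" "k < \<infinity>"
    and cov: "\<And>g. g \<in> borel_measurable borel \<Longrightarrow>
       (\<integral>\<^sup>+z. g z \<partial>lborel) = k * (\<integral>\<^sup>+p. g (\<phi> p) \<partial>lborel)"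
    using linear_change_of_variables[OF lin bij] by metis
  have \<phi>: "\<phi> \<in> borel_measurable borel" using lin by (rule borel_measurable_linear)
  have "(\<integral>\<^sup>+z. g z \<partial>lborel) = k * (\<integral>\<^sup>+y. (\<integral>\<^sup>+u. g (\<phi> (y, u)) \<partial>lborel) \<partial>lborel)"
    if g: "g \<in> borel_measurable borel" for g
  proof -
    have "(\<lambda>p. g (\<phi> p)) \<in> borel_measurable (lborel \<Otimes>\<^sub>M lborel)"
      using measurable_compose[OF \<phi> g] by (simp add: lborel_prod)
    then have "(\<integral>\<^sup>+y. (\<integral>\<^sup>+u. g (\<phi> (y, u)) \<partial>lborel) \<partial>lborel)
        = (\<integral>\<^sup>+p. g (\<phi> p) \<partial>(lborel \<Otimes>\<^sub>M lborel))"
      by (rule lborel.nn_integral_fst)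
    then show ?thesis by (simp add: cov[OF g] lborel_prod)
  qed
  then show thesis using that k by blast
qed

lemma emeasure_lborel_interval:
  assumes "0 \<le> r"
  shows "emeasure lborel {u. \<bar>t - u\<bar> < r} = ennreal (2 * r)"
proof -
  have "{u. \<bar>t - u\<bar> < r} = {t - r<..<t + r}" by auto
  then show ?thesis using assms by simp
qed

text \<open>
  Every \<open>u\<close> with \<open>\<bar>t - u\<bar> < r\<close> lies in \<open>(-L, L)\<close>, so \<open>F\<close> does not depend on the last variable on
  the ball in question. The integral over that variable contributes the factor \<open>2 * r\<close>, which is
  the ratio of the two normalizing volumes up to the factor \<open>k\<close> of \<open>\<phi>\<close>.
\<close>

lemma ball_average_cylinder:
  fixes B :: "(real ^ 'n) set" and B' :: "(real ^ 'm) set"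
    and \<phi> :: "(real ^ 'n) \<times> real \<Rightarrow> real ^ 'm"
  assumes card: "CARD('m) = CARD('n) + 1"
    and "open B" "open B'" and lin: "linear \<phi>" and bij: "bij \<phi>"
    and product: "\<And>x t. \<phi> (x, t) \<in> B' \<longleftrightarrow> x \<in> B \<and> \<bar>t\<bar> < 1"
    and [measurable]: "f \<in> borel_measurable borel" "F \<in> borel_measurable borel"
    and F: "\<And>x t. F (\<phi> (x, t)) = f x * indicator {-L<..<L} t"
    and "0 < r" "\<bar>t\<bar> + r \<le> L"
  shows "ball_average B' r F (\<phi> (x, t)) = ball_average B r f x"
proof -
  obtain k where k: "0 < k" "k < \<infinity>"
    and cov: "\<And>g. g \<in> borel_measurable borel \<Longrightarrow>
       (\<integral>\<^sup>+z. g z \<partial>lborel) = k * (\<integral>\<^sup>+y. (\<integral>\<^sup>+u. g (\<phi> (y, u)) \<partial>lborel) \<partial>lborel)"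
    using product_change_of_variables[OF lin bij] by metis
  have [measurable]: "B \<in> sets borel" "B' \<in> sets borel" using assms by auto
  have [measurable]: "(\<lambda>z. r *\<^sub>R z) ` B \<in> sets borel" "(\<lambda>z. r *\<^sub>R z) ` B' \<in> sets borel"
    using open_scaling[of r B] open_scaling[of r B'] assms by auto
  have [measurable]: "{u. \<bar>t - u\<bar> < \<rho>} \<in> sets borel" for t \<rho> :: real by measurable
  have scaled: "\<phi> (y, u) \<in> (\<lambda>z. r *\<^sub>R z) ` B' \<longleftrightarrow> y \<in> (\<lambda>z. r *\<^sub>R z) ` B \<and> \<bar>u\<bar> < r" for y u
  proof -
    have mem: "z \<in> (\<lambda>z. r *\<^sub>R z) ` A \<longleftrightarrow> (1 / r) *\<^sub>R z \<in> A" for z and A :: "'c::real_vector set"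
      using \<open>0 < r\<close> by (auto simp: image_iff intro: bexI[of _ "(1 / r) *\<^sub>R z"])
    have "(1 / r) *\<^sub>R \<phi> (y, u) = \<phi> ((1 / r) *\<^sub>R y, u / r)"
      by (simp add: linear_scale[OF lin, symmetric])
    then show ?thesis using \<open>0 < r\<close> by (simp add: mem product)
  qed
  define I where "I = (\<integral>\<^sup>+ y. indicator ((\<lambda>z. r *\<^sub>R z) ` B) (x - y) * ennreal \<bar>f y\<bar> \<partial>lborel)"
  have vol: "emeasure lborel B' = k * (emeasure lborel B * 2)"
  proof -
    have "emeasure lborel B' = (\<integral>\<^sup>+z. indicator B' z \<partial>lborel)" by simp
    also have "\<dots> = k * (\<integral>\<^sup>+y. (\<integral>\<^sup>+u. indicator B y * indicator {u::real. \<bar>0 - u\<bar> < 1} u \<partial>lborel) \<partial>lborel)"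
      by (subst cov) (auto intro!: arg_cong[of _ _ "(*) k"] nn_integral_cong
        simp: product indicator_def)
    also have "\<dots> = k * (emeasure lborel B * 2)"
      using emeasure_lborel_interval[of 1 0] by (simp add: nn_integral_cmult nn_integral_multc)
    finally show ?thesis .
  qed
  have "(\<integral>\<^sup>+ w. indicator ((\<lambda>z. r *\<^sub>R z) ` B') (\<phi> (x, t) - w) * ennreal \<bar>F w\<bar> \<partial>lborel)
      = k * (\<integral>\<^sup>+y. (\<integral>\<^sup>+u. indicator ((\<lambda>z. r *\<^sub>R z) ` B') (\<phi> (x, t) - \<phi> (y, u))
          * ennreal \<bar>F (\<phi> (y, u))\<bar> \<partial>lborel) \<partial>lborel)"
    by (rule cov) measurable
  also have "\<dots> = k * (\<integral>\<^sup>+y. (\<integral>\<^sup>+u. (indicator ((\<lambda>z. r *\<^sub>R z) ` B) (x - y) * ennreal \<bar>f y\<bar>)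
          * indicator {u. \<bar>t - u\<bar> < r} u \<partial>lborel) \<partial>lborel)"
  proof (intro arg_cong[of _ _ "(*) k"] nn_integral_cong)
    fix y and u :: real
    have "\<phi> (x, t) - \<phi> (y, u) = \<phi> (x - y, t - u)"
      by (simp add: linear_diff[OF lin, symmetric])
    moreover have "u \<in> {-L<..<L}" if "\<bar>t - u\<bar> < r" using that \<open>\<bar>t\<bar> + r \<le> L\<close> by auto
    ultimately show "indicator ((\<lambda>z. r *\<^sub>R z) ` B') (\<phi> (x, t) - \<phi> (y, u)) * ennreal \<bar>F (\<phi> (y, u))\<bar>
      = (indicator ((\<lambda>z. r *\<^sub>R z) ` B) (x - y) * ennreal \<bar>f y\<bar>) * indicator {u. \<bar>t - u\<bar> < r} u"
      by (simp add: indicator_def scaled F del: greaterThanLessThan_iff)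
  qed
  also have "\<dots> = k * (I * ennreal (2 * r))"
    using \<open>0 < r\<close> by (simp add: I_def nn_integral_cmult nn_integral_multc emeasure_lborel_interval)
  finally have "ball_average B' r F (\<phi> (x, t))
      = (k * (I * ennreal (2 * r))) / (ennreal (r ^ CARD('m)) * (k * (emeasure lborel B * 2)))"
    by (simp add: ball_average_lborel vol)
  also have "\<dots> = (I * (k * ennreal (2 * r)))
      / ((ennreal (r ^ CARD('n)) * emeasure lborel B) * (k * ennreal (2 * r)))"
    using \<open>0 < r\<close> by (simp add: card ennreal_mult mult_ac)
  also have "\<dots> = I / (ennreal (r ^ CARD('n)) * emeasure lborel B)"
    using k \<open>0 < r\<close> by (intro divide_mult_eq) (auto simp: ennreal_mult_eq_top_iff)
  finally show ?thesis by (simp add: ball_average_lborel I_def)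
qed

lemma ennreal_le_of_boundary_loss:
  fixes a b :: ennreal
  assumes le: "\<And>L. L > R \<Longrightarrow> a * ennreal (L - R) \<le> b * ennreal L" and "0 \<le> R"
  shows "a \<le> b"
proof (cases "b = \<infinity>")
  case False
  then obtain q where q: "b = ennreal q" "0 \<le> q" by (cases b) auto
  have "a \<noteq> \<infinity>"
    using le[of "R + 1"] q \<open>0 \<le> R\<close> by (auto simp: top_unique ennreal_mult_eq_top_iff)
  then obtain p where p: "a = ennreal p" "0 \<le> p" by (cases a) auto
  have *: "p * (L - R) \<le> q * L" if "L > R" for L
    using le[OF that] p q that \<open>0 \<le> R\<close> by (simp add: ennreal_mult[symmetric])
  have "p \<le> q"
  proof (rule ccontr)
    assume "\<not> p \<le> q"
    \<comment> \<open>the inequality at \<open>L\<close> says \<open>(p - q) * L \<le> p * R\<close>, so it fails beyond \<open>p * R / (p - q)\<close>\<close>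
    define L where "L = p * R / (p - q) + R + 1"
    have "L > R" using p \<open>0 \<le> R\<close> \<open>\<not> p \<le> q\<close> by (simp add: L_def add_nonneg_pos)
    then have "(p - q) * L \<le> p * R" using *[of L] by (simp add: algebra_simps)
    moreover have "(p - q) * L = p * R + (p - q) * (R + 1)"
      using \<open>\<not> p \<le> q\<close> by (simp add: L_def field_simps)
    moreover have "(p - q) * (R + 1) > 0" using \<open>\<not> p \<le> q\<close> \<open>0 \<le> R\<close> by simp
    ultimately show False by simp
  qed
  then show ?thesis using p q by (simp add: ennreal_leI)
qed simp

text \<open>
  Bounded radii ensure that the average at \<open>\<phi> (x, t)\<close> does not see the ends of the cylinder for
  \<open>\<bar>t\<bar> < L - R\<close>. The estimate for a fixed \<open>L\<close> loses the factor \<open>(L - R) / L\<close>, which tends to \<open>1\<close>.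
\<close>

lemma weak_type_bound_transfer_bounded_radii:
  fixes B :: "(real ^ 'n) set" and B' :: "(real ^ 'm) set"
    and \<phi> :: "(real ^ 'n) \<times> real \<Rightarrow> real ^ 'm"
  assumes card: "CARD('m) = CARD('n) + 1"
    and opn: "open B" "open B'" and lin: "linear \<phi>" and bij: "bij \<phi>"
    and product: "\<And>x t. \<phi> (x, t) \<in> B' \<longleftrightarrow> x \<in> B \<and> \<bar>t\<bar> < 1"
    and S: "S \<subseteq> {0<..}" and bound: "weak_type_bound (radii_maximal S B') c"
    and f: "integrable lborel f" and "0 < \<alpha>" "0 \<le> R"
  shows "ennreal \<alpha> * emeasure lborel {x. radii_maximal (S \<inter> {..R}) B f x > ennreal \<alpha>}
     \<le> c * (\<integral>\<^sup>+x. ennreal \<bar>f x\<bar> \<partial>lborel)"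
proof (rule ennreal_le_of_boundary_loss[OF _ \<open>0 \<le> R\<close>])
  fix L assume "L > R"
  have [measurable]: "f \<in> borel_measurable borel" using f by auto
  obtain k where k: "0 < k" "k < \<infinity>"
    and cov: "\<And>g. g \<in> borel_measurable borel \<Longrightarrow>
       (\<integral>\<^sup>+z. g z \<partial>lborel) = k * (\<integral>\<^sup>+y. (\<integral>\<^sup>+u. g (\<phi> (y, u)) \<partial>lborel) \<partial>lborel)"
    using product_change_of_variables[OF lin bij] by metis
  define F where "F = (\<lambda>z. f (fst (inv \<phi> z)) * indicator {-L<..<L} (snd (inv \<phi> z)))"
  have inv: "inv \<phi> \<in> borel_measurable borel"
    using lin bij by (intro borel_measurable_linear linear_inv_of_bij)
  have [measurable]: "(\<lambda>z. fst (inv \<phi> z)) \<in> borel_measurable borel"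
      "(\<lambda>z. snd (inv \<phi> z)) \<in> borel_measurable borel"
    by (rule measurable_compose[OF inv], intro borel_measurable_continuous_onI continuous_intros)+
  have F_meas [measurable]: "F \<in> borel_measurable borel" unfolding F_def by measurable
  have F: "F (\<phi> (x, t)) = f x * indicator {-L<..<L} t" for x t
    using bij by (simp add: F_def bij_is_inj)
  have "(\<integral>\<^sup>+z. ennreal \<bar>F z\<bar> \<partial>lborel)
      = k * (\<integral>\<^sup>+y. (\<integral>\<^sup>+u. ennreal \<bar>f y\<bar> * indicator {-L<..<L} u \<partial>lborel) \<partial>lborel)"
    by (subst cov) (auto simp: F abs_mult ennreal_mult intro!: arg_cong[of _ _ "(*) k"] nn_integral_cong
        split: split_indicator)
  also have "\<dots> = k * ((\<integral>\<^sup>+x. ennreal \<bar>f x\<bar> \<partial>lborel) * ennreal (2 * L))"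
    using \<open>L > R\<close> \<open>0 \<le> R\<close> by (simp add: nn_integral_cmult nn_integral_multc)
  finally have norm_F: "(\<integral>\<^sup>+z. ennreal \<bar>F z\<bar> \<partial>lborel)
      = k * ((\<integral>\<^sup>+x. ennreal \<bar>f x\<bar> \<partial>lborel) * ennreal (2 * L))" .
  have "(\<integral>\<^sup>+x. ennreal \<bar>f x\<bar> \<partial>lborel) < \<infinity>"
    using f by (simp add: integrable_iff_bounded)
  then have int_F: "integrable lborel F"
    using k by (simp add: integrable_iff_bounded norm_F ennreal_mult_less_top)
  define E where "E = {x. radii_maximal (S \<inter> {..R}) B f x > ennreal \<alpha>}"
  define G where "G = {z. radii_maximal S B' F z > ennreal \<alpha>}"
  have "open E" "open G"
    unfolding E_def G_def using S opn by (auto intro!: open_superlevel_radii_maximal)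
  then have [measurable]: "E \<in> sets borel" "G \<in> sets borel" by auto
  have in_G: "\<phi> (x, t) \<in> G" if "x \<in> E" "\<bar>t\<bar> < L - R" for x t
  proof -
    obtain r where r: "r \<in> S" "r \<le> R" "ball_average B r f x > ennreal \<alpha>"
      using \<open>x \<in> E\<close> by (auto simp: E_def radii_maximal_def less_SUP_iff)
    from r have "ball_average B' r F (\<phi> (x, t)) = ball_average B r f x"
      using S that(2) by (intro ball_average_cylinder[OF card opn lin bij product _ _ F]) auto
    then show ?thesis using r by (auto simp: G_def radii_maximal_def less_SUP_iff intro!: bexI[of _ r])
  qed
  have "k * (emeasure lborel E * ennreal (2 * (L - R)))
      = k * (\<integral>\<^sup>+y. (\<integral>\<^sup>+u. indicator E y * indicator {u. \<bar>0 - u\<bar> < L - R} u \<partial>lborel) \<partial>lborel)"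
    using emeasure_lborel_interval[of "L - R" 0] \<open>L > R\<close>
    by (simp add: nn_integral_cmult nn_integral_multc)
  also have "\<dots> \<le> k * (\<integral>\<^sup>+y. (\<integral>\<^sup>+u. indicator G (\<phi> (y, u)) \<partial>lborel) \<partial>lborel)"
    by (intro mult_left_mono nn_integral_mono) (auto simp: indicator_def in_G)
  also have "\<dots> = emeasure lborel G" by (subst cov[symmetric]) auto
  finally have "ennreal \<alpha> * (k * (emeasure lborel E * ennreal (2 * (L - R))))
      \<le> ennreal \<alpha> * emeasure lborel G" by (rule mult_left_mono) simp
  also have "\<dots> \<le> c * (\<integral>\<^sup>+z. ennreal \<bar>F z\<bar> \<partial>lborel)"
  proof -
    have "integrable lebesgue F" using int_F by (simp add: integrable_completion)
    then have "ennreal \<alpha> * emeasure lebesgue G \<le> c * ennreal (\<integral>z. \<bar>F z\<bar> \<partial>lebesgue)"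
      using bound \<open>0 < \<alpha>\<close> unfolding weak_type_bound_def G_def by blast
    then show ?thesis
      using int_F by (simp add: integral_completion nn_integral_eq_integral)
  qed
  also have "\<dots> = c * (k * ((\<integral>\<^sup>+x. ennreal \<bar>f x\<bar> \<partial>lborel) * ennreal (2 * L)))"
    by (simp only: norm_F)
  finally have scaled: "ennreal \<alpha> * (k * (emeasure lborel E * ennreal (2 * (L - R))))
      \<le> c * (k * ((\<integral>\<^sup>+x. ennreal \<bar>f x\<bar> \<partial>lborel) * ennreal (2 * L)))" .
  have two: "ennreal (2 * (L - R)) = 2 * ennreal (L - R)" "ennreal (2 * L) = 2 * ennreal L"
    using \<open>L > R\<close> \<open>0 \<le> R\<close> ennreal_mult[of 2 "L - R"] ennreal_mult[of 2 L] by simp_all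
  have "(k * 2) * (ennreal \<alpha> * emeasure lborel E * ennreal (L - R))
      \<le> (k * 2) * (c * (\<integral>\<^sup>+x. ennreal \<bar>f x\<bar> \<partial>lborel) * ennreal L)"
    using scaled unfolding two by (simp only: mult_ac)
  then show "ennreal \<alpha> * emeasure lborel {x. radii_maximal (S \<inter> {..R}) B f x > ennreal \<alpha>} * ennreal (L - R)
      \<le> c * (\<integral>\<^sup>+x. ennreal \<bar>f x\<bar> \<partial>lborel) * ennreal L"
    using k by (subst (asm) ennreal_mult_le_mult_iff) (auto simp: E_def ennreal_mult_eq_top_iff)
qed

text \<open>
  A value above \<open>\<alpha>\<close> is attained by a single average, hence at a radius below some integer \<open>N\<close>.
  The superlevel sets \<open>E N\<close> of the truncated operators thus increase to the full one. A Lebesgue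
  measurable \<open>f\<close> is replaced by a Borel function \<open>g\<close> that agrees with it almost everywhere, since
  averages do not see null sets.
\<close>

lemma weak_type_bound_transfer:
  fixes B :: "(real ^ 'n) set" and B' :: "(real ^ 'm) set"
  assumes card: "CARD('m) = CARD('n) + 1"
    and B: "centered_parallelotope B" and B': "centered_parallelotope B'"
    and S: "S \<subseteq> {0<..}" and bound: "weak_type_bound (radii_maximal S B') c"
  shows "weak_type_bound (radii_maximal S B) c"
  unfolding weak_type_bound_def
proof (intro allI impI)
  fix f :: "real ^ 'n \<Rightarrow> real" and \<alpha> :: real
  assume f: "integrable lebesgue f" and "\<alpha> > 0"
  note opn = centered_parallelotope_open[OF B] centered_parallelotope_open[OF B']
  obtain \<phi> :: "(real ^ 'n) \<times> real \<Rightarrow> real ^ 'm"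
    where \<phi>: "linear \<phi>" "bij \<phi>" "\<And>x t. \<phi> (x, t) \<in> B' \<longleftrightarrow> x \<in> B \<and> \<bar>t\<bar> < 1"
    using parallelotope_product[OF card B B'] by metis
  obtain g where g [measurable]: "g \<in> borel_measurable lborel" and "AE x in lborel. f x = g x"
    using completion_ex_borel_measurable_real[of f lborel] f by auto
  then have fg: "AE x in lebesgue. f x = g x" by (intro AE_completion)
  have int_g: "integrable lebesgue g"
    using f fg by (subst integrable_cong_AE[of g lebesgue f]) (auto intro: measurable_completion)
  then have int_g': "integrable lborel g" by (simp add: integrable_completion)
  have same_max: "radii_maximal S B f = radii_maximal S B g"
    by (simp add: radii_maximal_def fun_eq_iff ball_average_cong_AE[OF fg])
  have "(\<integral>x. \<bar>f x\<bar> \<partial>lebesgue) = (\<integral>x. \<bar>g x\<bar> \<partial>lebesgue)"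
    by (intro integral_cong_AE) (use f int_g fg in auto)
  then have norm_f: "ennreal (\<integral>x. \<bar>f x\<bar> \<partial>lebesgue) = (\<integral>\<^sup>+x. ennreal \<bar>g x\<bar> \<partial>lborel)"
    using int_g' by (simp add: integral_completion nn_integral_eq_integral)
  define E where "E N = {x. radii_maximal (S \<inter> {..real N}) B g x > ennreal \<alpha>}" for N
  have "open (E N)" for N
    unfolding E_def using S opn g by (intro open_superlevel_radii_maximal) auto
  then have E_meas: "range E \<subseteq> sets lborel" by auto
  have "incseq E"
    by (rule incseq_SucI)
       (auto simp: E_def radii_maximal_def elim!: less_le_trans intro!: SUP_subset_mono)
  have E_Un: "{x. radii_maximal S B g x > ennreal \<alpha>} = (\<Union>N. E N)"
    using real_arch_simple by (fastforce simp: E_def radii_maximal_def less_SUP_iff)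
  have "ennreal \<alpha> * emeasure lebesgue {x. radii_maximal S B f x > ennreal \<alpha>}
      = ennreal \<alpha> * emeasure lborel (\<Union>N. E N)"
    using E_meas by (simp add: same_max E_Un sets.countable_UN)
  also have "\<dots> = (SUP N. ennreal \<alpha> * emeasure lborel (E N))"
    by (simp add: SUP_emeasure_incseq[OF E_meas \<open>incseq E\<close>] SUP_mult_left_ennreal[symmetric])
  also have "\<dots> \<le> c * (\<integral>\<^sup>+x. ennreal \<bar>g x\<bar> \<partial>lborel)"
  proof (rule SUP_least)
    fix N
    show "ennreal \<alpha> * emeasure lborel (E N) \<le> c * (\<integral>\<^sup>+x. ennreal \<bar>g x\<bar> \<partial>lborel)"
      unfolding E_def using \<open>\<alpha> > 0\<close>
      by (intro weak_type_bound_transfer_bounded_radii[OF card opn \<phi> S bound int_g']) auto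
  qed
  finally show "ennreal \<alpha> * emeasure lebesgue {x. radii_maximal S B f x > ennreal \<alpha>}
      \<le> c * ennreal (\<integral>x. \<bar>f x\<bar> \<partial>lebesgue)"
    by (simp add: norm_f)
qed

lemma best_weak_constant_radii_maximal_mono:
  fixes B :: "(real ^ 'n) set" and B' :: "(real ^ 'm) set"
  assumes "CARD('m) = CARD('n) + 1" "centered_parallelotope B" "centered_parallelotope B'"
    and "S \<subseteq> {0<..}"
  shows "best_weak_constant (radii_maximal S B) \<le> best_weak_constant (radii_maximal S B')"
  unfolding best_weak_constant_def
  using weak_type_bound_transfer[OF assms] by (intro Inf_superset_mono) auto

theorem theorem5:
  fixes B :: "(real ^ 'n) set" and B' :: "(real ^ 'm) set"
  assumes "CARD('m) = CARD('n) + 1"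
    and "centered_parallelotope B"
    and "centered_parallelotope B'"
  shows "hl_constant B \<le> hl_constant B' \<and>
    (\<forall>s. lacunary_bisequence s \<longrightarrow> lacunary_constant s B \<le> lacunary_constant s B')"
proof (intro conjI allI impI)
  show "hl_constant B \<le> hl_constant B'"
    using best_weak_constant_radii_maximal_mono[OF assms, of "{0<..}"]
    by (simp add: hl_constant_def maximal_op_eq_radii_maximal)
next
  fix s assume "lacunary_bisequence s"
  then have "range s \<subseteq> {0<..}" by (auto simp: lacunary_bisequence_def)
  then show "lacunary_constant s B \<le> lacunary_constant s B'"
    using best_weak_constant_radii_maximal_mono[OF assms, of "range s"]
    by (simp add: lacunary_constant_def lacunary_maximal_op_eq_radii_maximal)
qed

end
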